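(* Let $\mathbf{r}_k=(r_{k,1},\dots,r_{k,M})$ be the collection of basic estimators, built from $\mathcal{D}_k$ only, with $\mathbb{E}|r_{k,m}(\mathbf{X})|^2<\infty$ for all $m=1,\dots,M$, and such that for each $m$ the sets $r_{k,m}^{-1}((t,+\infty))$ decrease to $\emptyset$ as $t\uparrow+\infty$ and the sets $r_{k,m}^{-1}((-\infty,t))$ decrease to $\emptyset$ as $t\downarrow-\infty$. Let $T_n(\mathbf{r}_k(\mathbf{x}))$ be the combined estimator with threshold $\varepsilon_\ell>0$. Then, for all distributions of $(\mathbf{X},Y)$ with $\mathbb{E}Y^2<\infty$, $$\mathbb{E}|T_n(\mathbf{r}_k(\mathbf{X}))-r^\star(\mathbf{X})|^2\le \mathbb{E}|T_n(\mathbf{r}_k(\mathbf{X}))-T(\mathbf{r}_k(\mathbf{X}))|^2+\inf_f \mathbb{E}|f(\mathbf{r}_k(\mathbf{X}))-r^\star(\mathbf{X})|^2,$$ where the infimum is taken over all square integrable functions of $\mathbf{r}_k(\mathbf{X})$ (i.e. all Borel $f:\mathbb{R}^M\to\mathbb{R}$ with $\mathbb{E}|f(\mathbf{r}_k(\mathbf{X}))|^2<\infty$). In particular, $$\mathbb{E}|T_n(\mathbf{r}_k(\mathbf{X}))-r^\star(\mathbf{X})|^2\le \min_{m=1,\dots,M}\mathbb{E}|r_{k,m}(\mathbf{X})-r^\star(\mathbf{X})|^2+\mathbb{E}|T_n(\mathbf{r}_k(\mathbf{X}))-T(\mathbf{r}_k(\mathbf{X}))|^2.$$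
   Context: Let $(\mathbf{X},Y)$ take values in $\mathbb{R}^d\times\mathbb{R}$ with $\mathbb{E}Y^2<\infty$, and let $r^\star(\mathbf{x})=\mathbb{E}[Y\mid\mathbf{X}=\mathbf{x}]$. The training sample $\mathcal{D}_n$ consists of $n$ i.i.d. copies of $(\mathbf{X},Y)$, independent of $(\mathbf{X},Y)$. It is split into its first $k$ elements $\mathcal{D}_k$ and the remaining $\ell=n-k\ge 1$ elements $\mathcal{D}_\ell$, which are renamed $(\mathbf{X}_1,Y_1),\dots,(\mathbf{X}_\ell,Y_\ell)$; in particular $\mathcal{D}_k$ and $\mathcal{D}_\ell$ are independent. Fix $M\ge 1$. The basic estimators (machines) $r_{k,1},\dots,r_{k,M}$ are arbitrary real-valued estimators of $r^\star$ on $\mathbb{R}^d$ (jointly measurable in the query point and the data) constructed from $\mathcal{D}_k$ alone; $\mathbf{r}_k(\mathbf{x})=(r_{k,1}(\mathbf{x}),\dots,r_{k,M}(\mathbf{x}))$. $r_{k,m}^{-1}(A)=\{\mathbf{x}\in\mathbb{R}^d: r_{k,m}(\mathbf{x})\in A\}$. For $\varepsilon_\ell>0$, the combined estimator is $T_n(\mathbf{r}_k(\mathbf{x}))=\sum_{i=1}^\ell W_{n,i}(\mathbf{x})Y_i$, $\mathbf{x}\in\mathbb{R}^d$, with $$W_{n,i}(\mathbf{x})=\frac{\mathbf{1}_{\bigcap_{m=1}^M\{|r_{k,m}(\mathbf{x})-r_{k,m}(\mathbf{X}_i)|\le\varepsilon_\ell\}}}{\sum_{j=1}^\ell\mathbf{1}_{\bigcap_{m=1}^M\{|r_{k,m}(\mathbf{x})-r_{k,m}(\mathbf{X}_j)|\le\varepsilon_\ell\}}},\qquad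 0/0=0.$$ $T(\mathbf{r}_k(\mathbf{X}))=\mathbb{E}[Y\mid\mathbf{r}_k(\mathbf{X})]$, where the conditional expectation is computed with the machines $\mathbf{r}_k$ (i.e. $\mathcal{D}_k$) held fixed: $T(\mathbf{r}_k(\mathbf{X}))=\mathbb{E}[Y\mid\mathbf{r}_k(\mathbf{X}),\mathcal{D}_k]$. Thus $T$ is, given $\mathcal{D}_k$, a function on $\mathbb{R}^M$. Unless conditioning is indicated, $\mathbb{E}$ is the expectation with respect to all random variables, including $\mathbf{X}$ and $\mathcal{D}_n$. *)

theory Defs
  imports "HOL-Probability.Probability"
begin

text \<open>
  \<open>is_regression_function M N Z Y g\<close>: the function \<open>g\<close> is a version of
  \<open>z \<mapsto> E[Y | Z = z]\<close>, where \<open>Z\<close> takes values in the measurable space \<open>N\<close>.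
  The sigma-algebra generated by \<open>Z\<close> is \<open>vimage_algebra (space M) Z N\<close>.
\<close>

definition is_regression_function ::
    "'w measure \<Rightarrow> 'z measure \<Rightarrow> ('w \<Rightarrow> 'z) \<Rightarrow> ('w \<Rightarrow> real) \<Rightarrow> ('z \<Rightarrow> real) \<Rightarrow> bool" where
  "is_regression_function M N Z Y g \<longleftrightarrow>
     g \<in> borel_measurable N \<and>
     (AE \<omega> in M. g (Z \<omega>) = real_cond_exp M (vimage_algebra (space M) Z N) Y \<omega>)"

definition sample :: "(nat \<Rightarrow> 'w \<Rightarrow> 'a) \<Rightarrow> nat \<Rightarrow> 'w \<Rightarrow> nat \<Rightarrow> 'a" where
  "sample D k \<omega> = (\<lambda>i\<in>{1..k}. D i \<omega>)"

text \<open>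
  Independence from \<open>Z\<close> is stated through the generated sigma-algebras because
  \<open>indep_var\<close> requires both variables to have values in the same type.
\<close>

definition iid_training_sample ::
    "'w measure \<Rightarrow> nat \<Rightarrow> (nat \<Rightarrow> 'w \<Rightarrow> 'a::topological_space) \<Rightarrow> ('w \<Rightarrow> 'a) \<Rightarrow> bool" where
  "iid_training_sample M n D Z \<longleftrightarrow>
     prob_space.indep_vars M (\<lambda>_. borel) D {1..n} \<and>
     (\<forall>i\<in>{1..n}. distr M borel (D i) = distr M borel Z) \<and>
     prob_space.indep_set M
       (sets (vimage_algebra (space M) (sample D n) (\<Pi>\<^sub>M i\<in>{1..n}. borel)))
       (sets (vimage_algebra (space M) Z borel))"

text \<open>
  The upper level sets decrease to the empty set as \<open>t\<close> increases to \<open>\<infinity>\<close>, the lower ones as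
  \<open>t\<close> decreases to \<open>-\<infinity>\<close>. Every real-valued function has this property.
\<close>

definition level_sets_vanish :: "('a \<Rightarrow> real) \<Rightarrow> bool" where
  "level_sets_vanish g \<longleftrightarrow>
     antimono (\<lambda>t. g -` {t<..}) \<and> (\<Inter>t. g -` {t<..}) = {} \<and>
     mono (\<lambda>t. g -` {..<t}) \<and> (\<Inter>t. g -` {..<t}) = {}"

text \<open>
  In the next two definitions \<open>\<rho>\<close> is the vector of machines with the first part of the data
  held fixed, and \<open>S 1, \<dots>, S l\<close> are the pairs of the second part. The quotient is \<open>0\<close>
  when its denominator vanishes.
\<close>

definition consensus_weight ::
    "nat \<Rightarrow> real \<Rightarrow> ('x \<Rightarrow> real ^ 'm) \<Rightarrow> (nat \<Rightarrow> 'x \<times> real) \<Rightarrow> 'x \<Rightarrow> nat \<Rightarrow> real" where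
  "consensus_weight l \<epsilon> \<rho> S x i =
     of_bool (\<forall>m. \<bar>\<rho> x $ m - \<rho> (fst (S i)) $ m\<bar> \<le> \<epsilon>) /
     (\<Sum>j=1..l. of_bool (\<forall>m. \<bar>\<rho> x $ m - \<rho> (fst (S j)) $ m\<bar> \<le> \<epsilon>))"

definition combined_estimator ::
    "nat \<Rightarrow> real \<Rightarrow> ('x \<Rightarrow> real ^ 'm) \<Rightarrow> (nat \<Rightarrow> 'x \<times> real) \<Rightarrow> 'x \<Rightarrow> real" where
  "combined_estimator l \<epsilon> \<rho> S x = (\<Sum>i=1..l. consensus_weight l \<epsilon> \<rho> S x i * snd (S i))"

text \<open>
  The expectation of \<open>|U - V|\<^sup>2\<close>, as an element of \<open>[0,\<infinity>]\<close>; unlike the Bochner integral, it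
  needs no integrability side condition to be meaningful.
\<close>

definition mean_square_error :: "'w measure \<Rightarrow> ('w \<Rightarrow> real) \<Rightarrow> ('w \<Rightarrow> real) \<Rightarrow> ennreal" where
  "mean_square_error M U V = (\<integral>\<^sup>+ \<omega>. ennreal (\<bar>U \<omega> - V \<omega>\<bar>\<^sup>2) \<partial>M)"

end

theory Submission
  imports Defs
begin

text \<open>
  The bound is Pythagoras' theorem in \<open>L\<^sup>2\<close>. Let \<open>S\<close> be the first block of the sample (on which
  the machines are built), \<open>V\<close> the second block, \<open>r\<^sub>S\<close> the machines, \<open>U = r\<^sup>\<star>(X)\<close>, and \<open>G\<close> the
  \<open>\<sigma>\<close>-algebra generated by \<open>(S, r\<^sub>S(X))\<close>. Suppose that \<open>T = E[U | G]\<close>. Then every \<open>G\<close>-measurable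
  \<open>W\<close> satisfies \<open>E|W - U|\<^sup>2 = E|W - T|\<^sup>2 + E|T - U|\<^sup>2\<close> (\<open>mean_square_error_pythagoras\<close>). With
  \<open>W = f(r\<^sub>S(X))\<close> this shows that \<open>E|T - U|\<^sup>2\<close> is at most the infimum over \<open>f\<close>; the coordinate
  functions are among the \<open>f\<close>, so it is also at most the error of each single machine. With
  \<open>W = T\<^sub>n\<close> it would give the claim, but there are two obstacles.

  First, \<open>T\<^sub>n\<close> also depends on \<open>V\<close> and is in general not \<open>G\<close>-measurable. However, \<open>V\<close> is independent of
  \<open>(S, X)\<close>, so Tonelli's theorem allows \<open>V\<close> to be replaced by an independent copy
  (\<open>nn_integral_indep_copy_middle\<close>). For each frozen value of that copy, the estimator is a
  function of \<open>(S, r\<^sub>S(X))\<close> and the identity applies; averaging over the copy gives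
  \<open>E|T\<^sub>n - U|\<^sup>2 = E|T\<^sub>n - T|\<^sup>2 + E|T - U|\<^sup>2\<close>. All errors are taken in \<open>[0,\<infinity>]\<close>, where the identity
  holds whether or not \<open>W\<close> is square integrable, so it applies to every frozen estimator.

  Second, \<open>T\<close> is given as \<open>E[Y | G]\<close>, not as \<open>E[r\<^sup>\<star>(X) | G]\<close>. The two agree because \<open>S\<close> is
  independent of \<open>(X, Y)\<close>: for each frozen value of \<open>S\<close>, an event in \<open>G\<close> becomes an event in
  \<open>\<sigma>(X)\<close>, over which \<open>Y\<close> and \<open>r\<^sup>\<star>(X)\<close> have the same integral
  (\<open>real_cond_exp_regression_function\<close>).
\<close>

section \<open>Independent random elements\<close>

abbreviation generated_events :: "'w measure \<Rightarrow> 'z measure \<Rightarrow> ('w \<Rightarrow> 'z) \<Rightarrow> 'w set set" where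
  "generated_events M N Z \<equiv> sets (vimage_algebra (space M) Z N)"

lemma generated_events_compose:
  assumes "Z \<in> measurable M N" "f \<in> measurable N N'"
  shows "generated_events M N' (\<lambda>\<omega>. f (Z \<omega>)) \<subseteq> generated_events M N Z"
proof (rule sets_image_in_sets)
  have "Z \<in> measurable (vimage_algebra (space M) Z N) N"
    using assms(1) by (intro measurable_vimage_algebra1) (auto dest: measurable_space)
  then show "(\<lambda>\<omega>. f (Z \<omega>)) \<in> measurable (vimage_algebra (space M) Z N) N'"
    using assms(2) by measurable
qed simp

context prob_space
begin

lemma indep_set_mono:
  assumes "indep_set A B" "A' \<subseteq> A" "B' \<subseteq> B"
  shows "indep_set A' B'"
  using assms unfolding indep_sets2_eq by blast

lemma indep_set_commute: "indep_set A B \<Longrightarrow> indep_set B A"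
  unfolding indep_sets2_eq by (metis Int_commute mult.commute)

text \<open>
  A product of probability measures is determined by its values on rectangles, where the claim is
  the product rule for two independent events. Independence is stated through generated events so
  that the two elements may have values in different types.
\<close>

lemma distr_Pair_indep:
  assumes [measurable]: "Z1 \<in> measurable M N1" "Z2 \<in> measurable M N2"
    and indep: "indep_set (generated_events M N1 Z1) (generated_events M N2 Z2)"
  shows "distr M (N1 \<Otimes>\<^sub>M N2) (\<lambda>\<omega>. (Z1 \<omega>, Z2 \<omega>)) = distr M N1 Z1 \<Otimes>\<^sub>M distr M N2 Z2"
proof (rule pair_measure_eqI[symmetric])
  show "sigma_finite_measure (distr M N1 Z1)" "sigma_finite_measure (distr M N2 Z2)"
    by (auto intro!: prob_space_imp_sigma_finite prob_space_distr)
  fix A B assume "A \<in> sets (distr M N1 Z1)" "B \<in> sets (distr M N2 Z2)"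
  then have [measurable]: "A \<in> sets N1" "B \<in> sets N2" by auto
  have eq: "(\<lambda>\<omega>. (Z1 \<omega>, Z2 \<omega>)) -` (A \<times> B) \<inter> space M
      = (Z1 -` A \<inter> space M) \<inter> (Z2 -` B \<inter> space M)"
    by auto
  have "prob ((Z1 -` A \<inter> space M) \<inter> (Z2 -` B \<inter> space M))
      = prob (Z1 -` A \<inter> space M) * prob (Z2 -` B \<inter> space M)"
    by (rule indep_setD[OF indep]) (auto intro: in_vimage_algebra)
  then show "emeasure (distr M N1 Z1) A * emeasure (distr M N2 Z2) B
      = emeasure (distr M (N1 \<Otimes>\<^sub>M N2) (\<lambda>\<omega>. (Z1 \<omega>, Z2 \<omega>))) (A \<times> B)"
    by (simp add: emeasure_distr eq emeasure_eq_measure ennreal_mult)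
qed simp

text \<open>
  Fubini's theorem for independent random elements, with the product of their distributions
  pulled back to \<open>M\<close>: integrating \<open>Z1\<close> over a second variable \<open>\<omega>'\<close> replaces it by an
  independent copy.
\<close>

lemma nn_integral_indep_copy:
  assumes [measurable]: "Z1 \<in> measurable M N1" "Z2 \<in> measurable M N2"
    and indep: "indep_set (generated_events M N1 Z1) (generated_events M N2 Z2)"
    and [measurable]: "F \<in> borel_measurable (N1 \<Otimes>\<^sub>M N2)"
  shows "(\<integral>\<^sup>+ \<omega>. F (Z1 \<omega>, Z2 \<omega>) \<partial>M) = (\<integral>\<^sup>+ \<omega>'. \<integral>\<^sup>+ \<omega>. F (Z1 \<omega>', Z2 \<omega>) \<partial>M \<partial>M)"
proof -
  interpret Z2: prob_space "distr M N2 Z2" by (rule prob_space_distr) fact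
  have "(\<integral>\<^sup>+ \<omega>. F (Z1 \<omega>, Z2 \<omega>) \<partial>M)
      = (\<integral>\<^sup>+ z. F z \<partial>distr M (N1 \<Otimes>\<^sub>M N2) (\<lambda>\<omega>. (Z1 \<omega>, Z2 \<omega>)))"
    by (simp add: nn_integral_distr)
  also have "\<dots> = (\<integral>\<^sup>+ z. F z \<partial>(distr M N1 Z1 \<Otimes>\<^sub>M distr M N2 Z2))"
    by (simp add: distr_Pair_indep[OF assms(1-3)])
  also have "\<dots> = (\<integral>\<^sup>+ x. \<integral>\<^sup>+ y. F (x, y) \<partial>distr M N2 Z2 \<partial>distr M N1 Z1)"
    by (rule Z2.nn_integral_fst[symmetric]) simp
  also have "\<dots> = (\<integral>\<^sup>+ \<omega>'. \<integral>\<^sup>+ y. F (Z1 \<omega>', y) \<partial>distr M N2 Z2 \<partial>M)"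
    by (rule nn_integral_distr) measurable
  also have "\<dots> = (\<integral>\<^sup>+ \<omega>'. \<integral>\<^sup>+ \<omega>. F (Z1 \<omega>', Z2 \<omega>) \<partial>M \<partial>M)"
    by (intro nn_integral_cong nn_integral_distr)
      (auto dest: measurable_space[OF assms(1)] intro: measurable_Pair2)
  finally show ?thesis .
qed

lemma integral_indep_copy:
  fixes F :: "_ \<Rightarrow> real"
  assumes [measurable]: "Z1 \<in> measurable M N1" "Z2 \<in> measurable M N2"
    and indep: "indep_set (generated_events M N1 Z1) (generated_events M N2 Z2)"
    and [measurable]: "F \<in> borel_measurable (N1 \<Otimes>\<^sub>M N2)"
    and int: "integrable M (\<lambda>\<omega>. F (Z1 \<omega>, Z2 \<omega>))"
  shows "(\<integral> \<omega>. F (Z1 \<omega>, Z2 \<omega>) \<partial>M) = (\<integral> \<omega>'. \<integral> \<omega>. F (Z1 \<omega>', Z2 \<omega>) \<partial>M \<partial>M)"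
proof -
  interpret Z1: prob_space "distr M N1 Z1" by (rule prob_space_distr) fact
  interpret Z2: prob_space "distr M N2 Z2" by (rule prob_space_distr) fact
  interpret pair_sigma_finite "distr M N1 Z1" "distr M N2 Z2" ..
  have "integrable (distr M N1 Z1 \<Otimes>\<^sub>M distr M N2 Z2) F"
    unfolding distr_Pair_indep[OF assms(1-3), symmetric] using int
    by (simp add: integrable_distr_eq)
  then have "integral\<^sup>L (distr M N1 Z1 \<Otimes>\<^sub>M distr M N2 Z2) F
      = (\<integral> x. \<integral> y. F (x, y) \<partial>distr M N2 Z2 \<partial>distr M N1 Z1)"
    by (rule integral_fst'[symmetric])
  also have "\<dots> = (\<integral> \<omega>'. \<integral> y. F (Z1 \<omega>', y) \<partial>distr M N2 Z2 \<partial>M)"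
    by (rule integral_distr) measurable
  also have "\<dots> = (\<integral> \<omega>'. \<integral> \<omega>. F (Z1 \<omega>', Z2 \<omega>) \<partial>M \<partial>M)"
    by (intro Bochner_Integration.integral_cong integral_distr)
      (auto dest: measurable_space[OF assms(1)] intro: measurable_Pair2)
  finally show ?thesis
    unfolding distr_Pair_indep[OF assms(1-3), symmetric] by (simp add: integral_distr)
qed

text \<open>
  Only the middle element \<open>B\<close> is replaced by a copy. Since \<open>A\<close>, \<open>B\<close> and \<open>C\<close> are independent, the
  pair \<open>(A, C)\<close> is independent of \<open>B\<close>. Instead of regrouping the \<open>\<sigma>\<close>-algebras, the proof splits
  the expectation into three integrals, one per element, and then merges those of \<open>A\<close> and \<open>C\<close>.
\<close>

lemma nn_integral_indep_copy_middle:
  assumes [measurable]: "A \<in> measurable M NA" "B \<in> measurable M NB" "C \<in> measurable M NC"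
    and indep_AB: "indep_set (generated_events M NA A) (generated_events M NB B)"
    and indep_ABC: "indep_set (generated_events M (NA \<Otimes>\<^sub>M NB) (\<lambda>\<omega>. (A \<omega>, B \<omega>)))
                      (generated_events M NC C)"
    and [measurable]: "F \<in> borel_measurable ((NA \<Otimes>\<^sub>M NB) \<Otimes>\<^sub>M NC)"
  shows "(\<integral>\<^sup>+ \<omega>. F ((A \<omega>, B \<omega>), C \<omega>) \<partial>M)
       = (\<integral>\<^sup>+ \<omega>'. \<integral>\<^sup>+ \<omega>. F ((A \<omega>, B \<omega>'), C \<omega>) \<partial>M \<partial>M)"
proof -
  have "generated_events M NA A \<subseteq> generated_events M (NA \<Otimes>\<^sub>M NB) (\<lambda>\<omega>. (A \<omega>, B \<omega>))"
    using generated_events_compose[of "\<lambda>\<omega>. (A \<omega>, B \<omega>)" M "NA \<Otimes>\<^sub>M NB" fst NA] by simp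
  then have indep_AC: "indep_set (generated_events M NA A) (generated_events M NC C)"
    using indep_ABC by (blast intro: indep_set_mono)
  have "(\<integral>\<^sup>+ \<omega>. F ((A \<omega>, B \<omega>), C \<omega>) \<partial>M) = (\<integral>\<^sup>+ \<omega>'. \<integral>\<^sup>+ \<omega>. F ((A \<omega>', B \<omega>'), C \<omega>) \<partial>M \<partial>M)"
    by (rule nn_integral_indep_copy[OF _ _ indep_ABC]) measurable
  also have "\<dots> = (\<integral>\<^sup>+ \<omega>'. \<integral>\<^sup>+ \<omega>''. \<integral>\<^sup>+ \<omega>. F ((A \<omega>'', B \<omega>'), C \<omega>) \<partial>M \<partial>M \<partial>M)"
    using nn_integral_indep_copy[OF _ _ indep_set_commute[OF indep_AB],
        where F = "\<lambda>(b, a). \<integral>\<^sup>+ \<omega>. F ((a, b), C \<omega>) \<partial>M"] by simp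
  also have "\<dots> = (\<integral>\<^sup>+ \<omega>'. \<integral>\<^sup>+ \<omega>. F ((A \<omega>, B \<omega>'), C \<omega>) \<partial>M \<partial>M)"
  proof (rule nn_integral_cong)
    fix \<omega>' assume "\<omega>' \<in> space M"
    then have [simp]: "B \<omega>' \<in> space NB" by (rule measurable_space[OF assms(2)])
    show "(\<integral>\<^sup>+ \<omega>''. \<integral>\<^sup>+ \<omega>. F ((A \<omega>'', B \<omega>'), C \<omega>) \<partial>M \<partial>M) = (\<integral>\<^sup>+ \<omega>. F ((A \<omega>, B \<omega>'), C \<omega>) \<partial>M)"
      using nn_integral_indep_copy[OF _ _ indep_AC, where F = "\<lambda>(a, c). F ((a, B \<omega>'), c)"]
      by simp
  qed
  finally show ?thesis .
qed

section \<open>Regression functions and independent side information\<close>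

lemma finite_measure_subalgebra_vimage:
  assumes "Z \<in> measurable M N"
  shows "finite_measure_subalgebra M (vimage_algebra (space M) Z N)"
  by unfold_locales (use assms sets_image_in_sets[of M "space M" Z N] in \<open>auto simp: subalgebra_def\<close>)

text \<open>
  An independent \<open>S\<close> says nothing about \<open>Y\<close> beyond what \<open>X\<close> says, so \<open>Y\<close> may be replaced by its
  regression on \<open>X\<close> under conditioning on any function of \<open>(S, X)\<close>. By Fubini, the integral over
  an event of \<open>G\<close> can be computed with \<open>S\<close> frozen; the event is then determined by \<open>X\<close> alone, and
  the defining property of \<open>E[Y | X]\<close> applies.
\<close>

lemma real_cond_exp_regression_function:
  assumes [measurable]: "S \<in> measurable M P" "X \<in> measurable M N" "\<phi> \<in> measurable (P \<Otimes>\<^sub>M N) L"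
    and int: "integrable M Y"
    and indep: "indep_set (generated_events M P S)
                  (generated_events M (N \<Otimes>\<^sub>M borel) (\<lambda>\<omega>. (X \<omega>, Y \<omega>)))"
    and g: "is_regression_function M N X Y g"
  defines "G \<equiv> vimage_algebra (space M) (\<lambda>\<omega>. \<phi> (S \<omega>, X \<omega>)) L"
  shows "AE \<omega> in M. real_cond_exp M G Y \<omega> = real_cond_exp M G (\<lambda>\<omega>. g (X \<omega>)) \<omega>"
proof -
  let ?E = "real_cond_exp M (vimage_algebra (space M) X N) Y"
  interpret X: finite_measure_subalgebra M "vimage_algebra (space M) X N"
    by (rule finite_measure_subalgebra_vimage) fact
  interpret G: finite_measure_subalgebra M G
    unfolding G_def by (rule finite_measure_subalgebra_vimage) measurable
  have [measurable]: "g \<in> borel_measurable N" and gX: "AE \<omega> in M. g (X \<omega>) = ?E \<omega>"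
    using g by (auto simp: is_regression_function_def)
  have [measurable]: "Y \<in> borel_measurable M" using int by auto
  have [measurable]: "X \<in> measurable (vimage_algebra (space M) X N) N"
    by (intro measurable_vimage_algebra1) (auto dest: measurable_space[OF assms(2)])
  have [measurable]: "?E \<in> borel_measurable M"
    by (rule borel_measurable_cond_exp2)
  have int_g: "integrable M (\<lambda>\<omega>. g (X \<omega>))"
    using X.real_cond_exp_int(1)[OF int] gX by (subst integrable_cong_AE[where g = ?E]) auto
  show ?thesis
  proof (rule G.real_cond_exp_charact)
    fix A assume A: "A \<in> sets G"
    then obtain B where [measurable]: "B \<in> sets L"
      and B: "A = (\<lambda>\<omega>. \<phi> (S \<omega>, X \<omega>)) -` B \<inter> space M"
      unfolding G_def by (subst (asm) sets_vimage_algebra2)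
        (auto dest: measurable_space[OF measurable_compose[OF measurable_Pair[OF assms(1,2)] assms(3)]])
    have [measurable]: "A \<in> sets M" unfolding B by measurable
    \<comment> \<open>the indicator of \<open>A\<close> as a function of the values of \<open>S\<close> and \<open>X\<close>, so that \<open>S\<close> can be frozen\<close>
    define q :: "_ \<Rightarrow> real" where "q z = indicator B (\<phi> z)" for z
    have [measurable]: "q \<in> borel_measurable (P \<Otimes>\<^sub>M N)" unfolding q_def by measurable
    have q: "indicator A \<omega> = q (S \<omega>, X \<omega>)" if "\<omega> \<in> space M" for \<omega>
      using that by (auto simp: q_def B indicator_def)
    have int_q: "integrable M (\<lambda>\<omega>. q (a \<omega>, X \<omega>) * f \<omega>)"
      if "integrable M f" "a \<in> measurable M P" for a f
      using that by (intro Bochner_Integration.integrable_bound[OF that(1)])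
        (auto simp: q_def indicator_def)
    have "(\<integral>\<omega>\<in>A. Y \<omega> \<partial>M) = (\<integral>\<omega>. q (S \<omega>, X \<omega>) * Y \<omega> \<partial>M)"
      unfolding set_lebesgue_integral_def by (intro Bochner_Integration.integral_cong) (auto simp: q)
    also have "\<dots> = (\<integral>\<omega>'. \<integral>\<omega>. q (S \<omega>', X \<omega>) * Y \<omega> \<partial>M \<partial>M)"
      using integral_indep_copy[OF _ _ indep, where F = "\<lambda>(s, x, y). q (s, x) * y"] int_q[OF int]
      by simp
    also have "\<dots> = (\<integral>\<omega>'. \<integral>\<omega>. q (S \<omega>', X \<omega>) * g (X \<omega>) \<partial>M \<partial>M)"
    proof (rule Bochner_Integration.integral_cong[OF refl])
      fix \<omega>' assume "\<omega>' \<in> space M"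
      then have [simp]: "S \<omega>' \<in> space P" by (rule measurable_space[OF assms(1)])
      have "(\<integral>\<omega>. q (S \<omega>', X \<omega>) * Y \<omega> \<partial>M) = (\<integral>\<omega>. q (S \<omega>', X \<omega>) * ?E \<omega> \<partial>M)"
        by (rule X.real_cond_exp_intg(2)[symmetric]) (use int_q[OF int] in auto)
      also have "\<dots> = (\<integral>\<omega>. q (S \<omega>', X \<omega>) * g (X \<omega>) \<partial>M)"
        using gX by (intro integral_cong_AE) auto
      finally show "(\<integral>\<omega>. q (S \<omega>', X \<omega>) * Y \<omega> \<partial>M) = (\<integral>\<omega>. q (S \<omega>', X \<omega>) * g (X \<omega>) \<partial>M)" .
    qed
    also have "\<dots> = (\<integral>\<omega>. q (S \<omega>, X \<omega>) * g (X \<omega>) \<partial>M)"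
      using integral_indep_copy[OF _ _ indep, where F = "\<lambda>(s, x, y). q (s, x) * g x"] int_q[OF int_g]
      by simp
    also have "\<dots> = (\<integral>\<omega>\<in>A. g (X \<omega>) \<partial>M)"
      unfolding set_lebesgue_integral_def by (intro Bochner_Integration.integral_cong) (auto simp: q)
    also have "\<dots> = (\<integral>\<omega>\<in>A. real_cond_exp M G (\<lambda>\<omega>. g (X \<omega>)) \<omega> \<partial>M)"
      by (rule G.real_cond_exp_intA) (use A int_g in auto)
    finally show "(\<integral>\<omega>\<in>A. Y \<omega> \<partial>M) = (\<integral>\<omega>\<in>A. real_cond_exp M G (\<lambda>\<omega>. g (X \<omega>)) \<omega> \<partial>M)" .
  qed (use int int_g G.real_cond_exp_int(1) in auto)
qed

end

section \<open>The Pythagorean identity\<close>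

lemma square_integrable_mult:
  fixes f g :: "'a \<Rightarrow> real"
  assumes [measurable]: "f \<in> borel_measurable M" "g \<in> borel_measurable M"
    and int: "integrable M (\<lambda>x. (f x)\<^sup>2)" "integrable M (\<lambda>x. (g x)\<^sup>2)"
  shows "integrable M (\<lambda>x. f x * g x)"
proof (rule Bochner_Integration.integrable_bound)
  show "integrable M (\<lambda>x. (f x)\<^sup>2 + (g x)\<^sup>2)" using int by simp
  have "\<bar>a * b\<bar> \<le> a\<^sup>2 + b\<^sup>2" for a b :: real
    using sum_squares_bound[of "\<bar>a\<bar>" "\<bar>b\<bar>"] mult_nonneg_nonneg[of "\<bar>a\<bar>" "\<bar>b\<bar>"]
    unfolding abs_mult power2_abs by linarith
  then show "AE x in M. norm (f x * g x) \<le> norm ((f x)\<^sup>2 + (g x)\<^sup>2)" by simp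
qed simp

lemma square_integrable_diff:
  fixes f g :: "'a \<Rightarrow> real"
  assumes "f \<in> borel_measurable M" "g \<in> borel_measurable M"
    and "integrable M (\<lambda>x. (f x)\<^sup>2)" "integrable M (\<lambda>x. (g x)\<^sup>2)"
  shows "integrable M (\<lambda>x. (f x - g x)\<^sup>2)"
  using assms square_integrable_mult[OF assms] by (simp add: power2_diff mult.assoc)

context finite_measure_subalgebra
begin

lemma square_integrable_real_cond_exp:
  assumes [measurable]: "U \<in> borel_measurable M" and U: "integrable M (\<lambda>\<omega>. (U \<omega>)\<^sup>2)"
  shows "integrable M (\<lambda>\<omega>. (real_cond_exp M F U \<omega>)\<^sup>2)"
  using square_integrable_imp_integrable[OF assms]
  by (intro integrable_convex_cond_exp[where I = UNIV and q = "\<lambda>x. x\<^sup>2"]) (use U in \<open>auto simp: convex_power2\<close>)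

text \<open>
  The cross term \<open>E[(W - V)(V - U)]\<close> vanishes because \<open>W - V\<close> is \<open>F\<close>-measurable and
  \<open>E[V - U | F] = 0\<close>. If \<open>W - V\<close> is not
  square integrable then neither is \<open>W - U\<close>, because \<open>V - U\<close> is, and both sides are infinite.
\<close>

lemma mean_square_error_pythagoras:
  assumes [measurable]: "U \<in> borel_measurable M" and U: "integrable M (\<lambda>\<omega>. (U \<omega>)\<^sup>2)"
    and W: "W \<in> borel_measurable F"
  defines "V \<equiv> real_cond_exp M F U"
  shows "mean_square_error M W U = mean_square_error M W V + mean_square_error M V U"
proof -
  have [measurable]: "W \<in> borel_measurable M"
    by (rule measurable_from_subalg[OF subalg W])
  have V_F: "V \<in> borel_measurable F" unfolding V_def by simp
  have [measurable]: "V \<in> borel_measurable M"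
    by (rule measurable_from_subalg[OF subalg V_F])
  have VU: "integrable M (\<lambda>\<omega>. (V \<omega> - U \<omega>)\<^sup>2)"
    using square_integrable_real_cond_exp[OF _ U] U unfolding V_def[symmetric]
    by (intro square_integrable_diff) auto
  have mse: "mean_square_error M A B = ennreal (\<integral>\<omega>. (A \<omega> - B \<omega>)\<^sup>2 \<partial>M)"
    if "integrable M (\<lambda>\<omega>. (A \<omega> - B \<omega>)\<^sup>2)" for A B
    unfolding mean_square_error_def using that by (simp add: nn_integral_eq_integral)
  show ?thesis
  proof (cases "integrable M (\<lambda>\<omega>. (W \<omega> - V \<omega>)\<^sup>2)")
    case True
    have prod: "integrable M (\<lambda>\<omega>. (W \<omega> - V \<omega>) * U \<omega>)"
      "integrable M (\<lambda>\<omega>. (W \<omega> - V \<omega>) * (V \<omega> - U \<omega>))"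
      using True U VU by (auto intro!: square_integrable_mult)
    have "(\<integral>\<omega>. (W \<omega> - V \<omega>) * V \<omega> \<partial>M) = (\<integral>\<omega>. (W \<omega> - V \<omega>) * U \<omega> \<partial>M)"
      "integrable M (\<lambda>\<omega>. (W \<omega> - V \<omega>) * V \<omega>)"
      using real_cond_exp_intg[of "\<lambda>\<omega>. W \<omega> - V \<omega>" U, folded V_def] prod(1) W V_F by auto
    then have orth: "(\<integral>\<omega>. (W \<omega> - V \<omega>) * (V \<omega> - U \<omega>) \<partial>M) = 0"
      using prod(1) by (simp add: right_diff_distrib)
    have sq: "(W \<omega> - U \<omega>)\<^sup>2
        = (W \<omega> - V \<omega>)\<^sup>2 + 2 * ((W \<omega> - V \<omega>) * (V \<omega> - U \<omega>)) + (V \<omega> - U \<omega>)\<^sup>2" for \<omega>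
      by (simp add: power2_eq_square algebra_simps)
    have "integrable M (\<lambda>\<omega>. (W \<omega> - U \<omega>)\<^sup>2)"
      unfolding sq using True VU prod(2) by auto
    moreover have "(\<integral>\<omega>. (W \<omega> - U \<omega>)\<^sup>2 \<partial>M)
        = (\<integral>\<omega>. (W \<omega> - V \<omega>)\<^sup>2 \<partial>M) + (\<integral>\<omega>. (V \<omega> - U \<omega>)\<^sup>2 \<partial>M)"
      unfolding sq using True VU prod(2) orth by simp
    ultimately show ?thesis
      using True VU by (simp add: mse)
  next
    case False
    have "\<not> integrable M (\<lambda>\<omega>. (W \<omega> - U \<omega>)\<^sup>2)"
    proof
      assume "integrable M (\<lambda>\<omega>. (W \<omega> - U \<omega>)\<^sup>2)"
      then have "integrable M (\<lambda>\<omega>. ((W \<omega> - U \<omega>) - (V \<omega> - U \<omega>))\<^sup>2)"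
        using square_integrable_diff[of "\<lambda>\<omega>. W \<omega> - U \<omega>" M "\<lambda>\<omega>. V \<omega> - U \<omega>"] VU by simp
      with False show False by simp
    qed
    then have "mean_square_error M W U = \<infinity>"
      unfolding mean_square_error_def by (simp add: integrable_iff_bounded flip: less_top)
    moreover have "mean_square_error M W V = \<infinity>"
      using False unfolding mean_square_error_def by (simp add: integrable_iff_bounded flip: less_top)
    ultimately show ?thesis by simp
  qed
qed

end


section \<open>The combined estimator as a function of the machines\<close>

text \<open>
  The query point enters the combined estimator only through the machine outputs there; this is
  the resulting function of the outputs \<open>z\<close>, the \<open>T\<^sub>n\<close> of the notation \<open>T\<^sub>n(r\<^sub>k(x))\<close>. This form
  makes visible that, with the second block of data frozen, the estimator is measurable with
  respect to the first block and the machine outputs.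
\<close>

definition consensus_average ::
    "nat \<Rightarrow> real \<Rightarrow> ('x \<Rightarrow> real ^ 'm) \<Rightarrow> (nat \<Rightarrow> 'x \<times> real) \<Rightarrow> real ^ 'm \<Rightarrow> real" where
  "consensus_average l \<epsilon> \<rho> S z =
     (\<Sum>i=1..l. of_bool (\<forall>m. \<bar>z $ m - \<rho> (fst (S i)) $ m\<bar> \<le> \<epsilon>) /
       (\<Sum>j=1..l. of_bool (\<forall>m. \<bar>z $ m - \<rho> (fst (S j)) $ m\<bar> \<le> \<epsilon>)) * snd (S i))"

lemma combined_estimator_eq_consensus_average:
  "combined_estimator l \<epsilon> \<rho> S x = consensus_average l \<epsilon> \<rho> S (\<rho> x)"
  by (simp add: combined_estimator_def consensus_weight_def consensus_average_def)

lemma consensus_average_cong: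
  assumes "\<And>i. i \<in> {1..l} \<Longrightarrow> S i = S' i"
  shows "consensus_average l \<epsilon> \<rho> S z = consensus_average l \<epsilon> \<rho> S' z"
proof -
  have "(\<Sum>j=1..l. of_bool (\<forall>m. \<bar>z $ m - \<rho> (fst (S j)) $ m\<bar> \<le> \<epsilon>) :: real)
      = (\<Sum>j=1..l. of_bool (\<forall>m. \<bar>z $ m - \<rho> (fst (S' j)) $ m\<bar> \<le> \<epsilon>))"
    by (rule sum.cong) (simp_all add: assms)
  then show ?thesis
    unfolding consensus_average_def by (intro sum.cong refl) (simp only: assms)
qed

lemma borel_measurable_component:
  "(\<lambda>z. z $ m) \<in> borel_measurable (borel :: (real ^ 'm) measure)"
  by (intro borel_measurable_continuous_onI continuous_intros)

text \<open>
  The first block of data enters only through \<open>s\<close>, the second only through \<open>v\<close>. Joint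
  measurability allows both integrating over \<open>v\<close> and freezing it; after freezing, what is left
  is a measurable function of \<open>s\<close> and of the machine outputs \<open>z\<close>.
\<close>

lemma borel_measurable_consensus_average:
  fixes r :: "'s \<Rightarrow> 'x::second_countable_topology \<Rightarrow> real ^ 'm"
  assumes [measurable]: "(\<lambda>(s, x). r s x) \<in> borel_measurable (P \<Otimes>\<^sub>M borel)"
    and J: "\<And>i. i \<in> {1..l} \<Longrightarrow> k + i \<in> J"
  shows "(\<lambda>((s, v), z). consensus_average l \<epsilon> (r s) (\<lambda>i. v (k + i)) z)
    \<in> borel_measurable ((P \<Otimes>\<^sub>M (\<Pi>\<^sub>M i\<in>J. borel)) \<Otimes>\<^sub>M borel)"
proof -
  let ?N = "(P \<Otimes>\<^sub>M (\<Pi>\<^sub>M i\<in>J. (borel :: ('x \<times> real) measure))) \<Otimes>\<^sub>M (borel :: (real ^ 'm) measure)"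
  have d: "(\<lambda>p. snd (fst p) (k + i)) \<in> measurable ?N (borel \<Otimes>\<^sub>M borel)" if "i \<in> {1..l}" for i
    unfolding borel_prod
    by (rule measurable_compose[OF measurable_compose[OF measurable_fst measurable_snd]
          measurable_component_singleton[OF J[OF that]]])
  have snd_d: "(\<lambda>p. snd (snd (fst p) (k + i))) \<in> borel_measurable ?N" if "i \<in> {1..l}" for i
    by (rule measurable_compose[OF d[OF that] measurable_snd])
  have r_d: "(\<lambda>p. r (fst (fst p)) (fst (snd (fst p) (k + i)))) \<in> borel_measurable ?N"
    if "i \<in> {1..l}" for i
    using measurable_compose[OF measurable_Pair[OF measurable_compose[OF measurable_fst measurable_fst]
          measurable_compose[OF d[OF that] measurable_fst]] assms(1)]
    by simp
  have vote: "(\<lambda>p. of_bool (\<forall>m. \<bar>snd p $ m - r (fst (fst p)) (fst (snd (fst p) (k + i))) $ m\<bar> \<le> \<epsilon>) :: real)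
      \<in> borel_measurable ?N" if "i \<in> {1..l}" for i
  proof -
    have [measurable]: "(\<lambda>p. snd p $ m) \<in> borel_measurable ?N"
      "(\<lambda>p. r (fst (fst p)) (fst (snd (fst p) (k + i))) $ m) \<in> borel_measurable ?N" for m
      by (rule measurable_compose[OF measurable_snd borel_measurable_component] measurable_compose[OF r_d[OF that] borel_measurable_component])+
    have "{p \<in> space ?N. \<forall>m\<in>UNIV. \<bar>snd p $ m - r (fst (fst p)) (fst (snd (fst p) (k + i))) $ m\<bar> \<le> \<epsilon>} \<in> sets ?N"
      by (intro sets.sets_Collect_finite_All' borel_measurable_le borel_measurable_abs
          borel_measurable_diff borel_measurable_const) (auto)
    then show ?thesis
      unfolding of_bool_def by (intro measurable_If borel_measurable_const) auto
  qed
  show ?thesis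
    unfolding consensus_average_def split_beta'
    by (intro borel_measurable_sum borel_measurable_times borel_measurable_divide vote snd_d)
qed

section \<open>The training sample\<close>

text \<open>
  The blocks \<open>S\<close> and \<open>V\<close> are independent as they use disjoint sets of indices of an independent
  family, and \<open>(S, V)\<close> is independent of \<open>Z\<close> as it is a function of the whole sample. This is the
  form of mutual independence that \<open>nn_integral_indep_copy_middle\<close> takes.
\<close>

lemma (in prob_space) iid_training_sample_split:
  fixes D :: "nat \<Rightarrow> 'a \<Rightarrow> 'b::topological_space" and Z :: "'a \<Rightarrow> 'b"
  assumes iid: "iid_training_sample M n D Z" and "k \<le> n"
  defines "S \<equiv> sample D k" and "V \<equiv> \<lambda>\<omega>. \<lambda>i\<in>{k+1..n}. D i \<omega>"
    and "P \<equiv> \<Pi>\<^sub>M i\<in>{1..k}. borel" and "Q \<equiv> \<Pi>\<^sub>M i\<in>{k+1..n}. borel"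
  shows "S \<in> measurable M P" "V \<in> measurable M Q"
    and "indep_set (generated_events M P S) (generated_events M Q V)"
    and "indep_set (generated_events M (P \<Otimes>\<^sub>M Q) (\<lambda>\<omega>. (S \<omega>, V \<omega>))) (generated_events M borel Z)"
proof -
  have indep: "indep_vars (\<lambda>_. borel) D {1..n}"
    and indep_Z: "indep_set (generated_events M (\<Pi>\<^sub>M i\<in>{1..n}. borel) (sample D n))
        (generated_events M borel Z)"
    using iid by (auto simp: iid_training_sample_def)
  have D: "random_variable borel (D i)" if "i \<in> {1..n}" for i
    using indep that by (auto simp: indep_vars_def)
  show "S \<in> measurable M P" "V \<in> measurable M Q"
    unfolding S_def V_def P_def Q_def sample_def
    using \<open>k \<le> n\<close> by (auto intro!: measurable_restrict D)
  have "indep_var P S Q V"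
    unfolding S_def V_def P_def Q_def sample_def
    using indep_var_restrict[OF indep, of "{1..k}" "{k+1..n}"] \<open>k \<le> n\<close> by auto
  then show "indep_set (generated_events M P S) (generated_events M Q V)"
    by (simp add: indep_var_eq sets_vimage_algebra)
  let ?split = "\<lambda>q. (restrict q {1..k}, restrict q {k+1..n})"
  have "?split \<in> measurable (\<Pi>\<^sub>M i\<in>{1..n}. borel :: 'b measure) (P \<Otimes>\<^sub>M Q)"
    unfolding P_def Q_def using \<open>k \<le> n\<close>
    by (intro measurable_Pair measurable_restrict_subset) auto
  moreover have "sample D n \<in> measurable M (\<Pi>\<^sub>M i\<in>{1..n}. borel)"
    unfolding sample_def by (intro measurable_restrict D)
  moreover have "?split (sample D n \<omega>) = (S \<omega>, V \<omega>)" for \<omega>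
    using \<open>k \<le> n\<close> by (auto simp: S_def V_def sample_def fun_eq_iff)
  ultimately have "generated_events M (P \<Otimes>\<^sub>M Q) (\<lambda>\<omega>. (S \<omega>, V \<omega>))
      \<subseteq> generated_events M (\<Pi>\<^sub>M i\<in>{1..n}. borel) (sample D n)"
    using generated_events_compose[of "sample D n" M _ ?split "P \<Otimes>\<^sub>M Q"] by simp
  then show "indep_set (generated_events M (P \<Otimes>\<^sub>M Q) (\<lambda>\<omega>. (S \<omega>, V \<omega>))) (generated_events M borel Z)"
    using indep_Z by (blast intro: indep_set_mono)
qed

section \<open>The risk bound\<close>

theorem proposition2p1:
  fixes M :: "'w measure"
    and X :: "'w \<Rightarrow> real ^ 'd" and Y :: "'w \<Rightarrow> real"
    and D :: "nat \<Rightarrow> 'w \<Rightarrow> (real ^ 'd) \<times> real"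
    and n k l :: nat and \<epsilon> :: real
    and r :: "(nat \<Rightarrow> (real ^ 'd) \<times> real) \<Rightarrow> real ^ 'd \<Rightarrow> real ^ 'm"
    and rstar :: "real ^ 'd \<Rightarrow> real"
    and T :: "(nat \<Rightarrow> (real ^ 'd) \<times> real) \<Rightarrow> real ^ 'm \<Rightarrow> real"
  defines "rk \<equiv> \<lambda>\<omega>. r (sample D k \<omega>)"
  defines "Tn \<equiv> \<lambda>\<omega>. combined_estimator l \<epsilon> (rk \<omega>) (\<lambda>i. D (k + i) \<omega>) (X \<omega>)"
  defines "TX \<equiv> \<lambda>\<omega>. T (sample D k \<omega>) (rk \<omega> (X \<omega>))"
  assumes "prob_space M"
    and "X \<in> borel_measurable M" and "Y \<in> borel_measurable M"
    and "integrable M (\<lambda>\<omega>. (Y \<omega>)\<^sup>2)"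
    and "is_regression_function M borel X Y rstar"
    and "n = k + l" and "1 \<le> l" and "0 < \<epsilon>"
    and "iid_training_sample M n D (\<lambda>\<omega>. (X \<omega>, Y \<omega>))"
    and "(\<lambda>(s, x). r s x) \<in> borel_measurable ((\<Pi>\<^sub>M i\<in>{1..k}. borel) \<Otimes>\<^sub>M borel)"
    and "\<And>m. integrable M (\<lambda>\<omega>. \<bar>rk \<omega> (X \<omega>) $ m\<bar>\<^sup>2)"
    and "\<And>m \<omega>. \<omega> \<in> space M \<Longrightarrow> level_sets_vanish (\<lambda>x. rk \<omega> x $ m)"
    and "is_regression_function M ((\<Pi>\<^sub>M i\<in>{1..k}. borel) \<Otimes>\<^sub>M borel)
           (\<lambda>\<omega>. (sample D k \<omega>, rk \<omega> (X \<omega>))) Y (\<lambda>(s, z). T s z)"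
  shows "mean_square_error M Tn (\<lambda>\<omega>. rstar (X \<omega>))
           \<le> mean_square_error M Tn TX
             + (INF f \<in> {f \<in> borel_measurable borel. integrable M (\<lambda>\<omega>. \<bar>f (rk \<omega> (X \<omega>))\<bar>\<^sup>2)}.
                  mean_square_error M (\<lambda>\<omega>. f (rk \<omega> (X \<omega>))) (\<lambda>\<omega>. rstar (X \<omega>)))
       \<and> mean_square_error M Tn (\<lambda>\<omega>. rstar (X \<omega>))
           \<le> (MIN m. mean_square_error M (\<lambda>\<omega>. rk \<omega> (X \<omega>) $ m) (\<lambda>\<omega>. rstar (X \<omega>)))
             + mean_square_error M Tn TX"
proof -
  interpret prob_space M by fact
  note [measurable] = \<open>X \<in> borel_measurable M\<close> \<open>Y \<in> borel_measurable M\<close>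
  define P where "P = (\<Pi>\<^sub>M i\<in>{1..k}. (borel :: ((real ^ 'd) \<times> real) measure))"
  define Q where "Q = (\<Pi>\<^sub>M i\<in>{k+1..n}. (borel :: ((real ^ 'd) \<times> real) measure))"
  define S where "S = sample D k"
  define V where "V = (\<lambda>\<omega>. \<lambda>i\<in>{k+1..n}. D i \<omega>)"
  define U where "U = (\<lambda>\<omega>. rstar (X \<omega>))"
  define h where "h = (\<lambda>((s, v), z). consensus_average l \<epsilon> (r s) (\<lambda>i. v (k + i)) z)"
  define G where "G = vimage_algebra (space M) (\<lambda>\<omega>. (S \<omega>, r (S \<omega>) (X \<omega>))) (P \<Otimes>\<^sub>M borel)"
  have "k \<le> n" using \<open>n = k + l\<close> by simp
  note split = iid_training_sample_split[OF \<open>iid_training_sample M n D _\<close> \<open>k \<le> n\<close>]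
  have [measurable]: "S \<in> measurable M P" and V [measurable]: "V \<in> measurable M Q"
    using split(1,2) unfolding S_def V_def P_def Q_def by auto
  have indep_S_V: "indep_set (generated_events M P S) (generated_events M Q V)"
    using split(3) unfolding S_def V_def P_def Q_def .
  have indep_SV_XY: "indep_set (generated_events M (P \<Otimes>\<^sub>M Q) (\<lambda>\<omega>. (S \<omega>, V \<omega>)))
      (generated_events M (borel \<Otimes>\<^sub>M borel) (\<lambda>\<omega>. (X \<omega>, Y \<omega>)))"
    using split(4) unfolding S_def V_def P_def Q_def borel_prod .
  have indep_S_XY: "indep_set (generated_events M P S)
      (generated_events M (borel \<Otimes>\<^sub>M borel) (\<lambda>\<omega>. (X \<omega>, Y \<omega>)))"
    using indep_SV_XY generated_events_compose[of "\<lambda>\<omega>. (S \<omega>, V \<omega>)" M "P \<Otimes>\<^sub>M Q" fst P]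
    by (auto intro: indep_set_mono)
  have indep_SV_X: "indep_set (generated_events M (P \<Otimes>\<^sub>M Q) (\<lambda>\<omega>. (S \<omega>, V \<omega>)))
      (generated_events M borel X)"
    using indep_SV_XY
      generated_events_compose[of "\<lambda>\<omega>. (X \<omega>, Y \<omega>)" M "borel \<Otimes>\<^sub>M borel" fst borel]
    by (auto intro: indep_set_mono)
  have r [measurable]: "(\<lambda>(s, x). r s x) \<in> borel_measurable (P \<Otimes>\<^sub>M borel)"
    using assms(13) by (simp add: P_def)
  have [measurable]: "h \<in> borel_measurable ((P \<Otimes>\<^sub>M Q) \<Otimes>\<^sub>M borel)"
    unfolding h_def Q_def using r \<open>n = k + l\<close>
    by (intro borel_measurable_consensus_average) auto
  have [measurable]: "rstar \<in> borel_measurable borel"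
    using assms(8) by (simp add: is_regression_function_def)
  have [measurable]: "(\<lambda>(s, z). T s z) \<in> borel_measurable (P \<Otimes>\<^sub>M borel)"
    and TX: "AE \<omega> in M. TX \<omega> = real_cond_exp M G Y \<omega>"
    using assms(16) by (auto simp: is_regression_function_def TX_def rk_def P_def S_def G_def)

  have int_Y: "integrable M Y"
    using square_integrable_imp_integrable[of Y] assms(7) by simp
  interpret X: finite_measure_subalgebra M "vimage_algebra (space M) X borel"
    by (rule finite_measure_subalgebra_vimage) measurable
  interpret G: finite_measure_subalgebra M G
    unfolding G_def by (rule finite_measure_subalgebra_vimage) measurable
  have SR_G [measurable]: "(\<lambda>\<omega>. (S \<omega>, r (S \<omega>) (X \<omega>))) \<in> measurable G (P \<Otimes>\<^sub>M borel)"
  proof -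
    have "(\<lambda>\<omega>. (S \<omega>, r (S \<omega>) (X \<omega>))) \<in> measurable M (P \<Otimes>\<^sub>M borel)" by measurable
    then show ?thesis
      unfolding G_def by (intro measurable_vimage_algebra1 funcsetI) (rule measurable_space)
  qed
  have [measurable]: "U \<in> borel_measurable M" unfolding U_def by measurable
  have sq_U: "integrable M (\<lambda>\<omega>. (U \<omega>)\<^sup>2)"
  proof -
    let ?E = "real_cond_exp M (vimage_algebra (space M) X borel) Y"
    have [measurable]: "?E \<in> borel_measurable M" by (rule borel_measurable_cond_exp2)
    have "AE \<omega> in M. U \<omega> = ?E \<omega>"
      using assms(8) by (simp add: is_regression_function_def U_def)
    then show ?thesis
      using X.square_integrable_real_cond_exp[OF _ assms(7)]
      by (subst integrable_cong_AE[where g = "\<lambda>\<omega>. (?E \<omega>)\<^sup>2"]) auto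
  qed
  have "(\<lambda>(s, x). (s, r s x)) \<in> measurable (P \<Otimes>\<^sub>M borel) (P \<Otimes>\<^sub>M borel)"
    using measurable_Pair[OF measurable_fst r] by (simp add: split_beta')
  from real_cond_exp_regression_function[OF \<open>S \<in> measurable M P\<close> \<open>X \<in> borel_measurable M\<close>
      this int_Y indep_S_XY assms(8)]
  have "AE \<omega> in M. real_cond_exp M G Y \<omega> = real_cond_exp M G U \<omega>"
    unfolding G_def U_def prod.case .
  with TX have TX_U: "AE \<omega> in M. TX \<omega> = real_cond_exp M G U \<omega>" by auto

  have pythagoras: "mean_square_error M W U = mean_square_error M W TX + mean_square_error M TX U"
    if "W \<in> borel_measurable G" for W
  proof -
    have "mean_square_error M W TX = mean_square_error M W (real_cond_exp M G U)"
      "mean_square_error M TX U = mean_square_error M (real_cond_exp M G U) U"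
      unfolding mean_square_error_def using TX_U by (auto intro!: nn_integral_cong_AE)
    with G.mean_square_error_pythagoras[OF _ sq_U that] show ?thesis by simp
  qed

  \<comment> \<open>the combined estimator with its second block of data taken from the copy \<open>\<omega>'\<close>\<close>
  define W where "W \<omega>' \<omega> = h ((S \<omega>, V \<omega>'), r (S \<omega>) (X \<omega>))" for \<omega>' \<omega>
  have Tn: "Tn \<omega> = W \<omega> \<omega>" for \<omega>
    unfolding Tn_def rk_def combined_estimator_eq_consensus_average W_def h_def S_def prod.case
    by (rule consensus_average_cong) (simp add: V_def \<open>n = k + l\<close>)
  have W_G: "W \<omega>' \<in> borel_measurable G" if "\<omega>' \<in> space M" for \<omega>'
  proof -
    have [simp]: "V \<omega>' \<in> space Q" by (rule measurable_space[OF V that])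
    have "(\<lambda>(s, z). h ((s, V \<omega>'), z)) \<in> borel_measurable (P \<Otimes>\<^sub>M borel)" by measurable
    from measurable_compose[OF SR_G this] show ?thesis unfolding W_def[abs_def] by simp
  qed
  have mse_Tn: "mean_square_error M Tn (\<lambda>\<omega>. f (S \<omega>, X \<omega>)) = (\<integral>\<^sup>+ \<omega>'. mean_square_error M (W \<omega>') (\<lambda>\<omega>. f (S \<omega>, X \<omega>)) \<partial>M)"
    if [measurable]: "f \<in> borel_measurable (P \<Otimes>\<^sub>M borel)" for f
  proof -
    let ?F = "\<lambda>p. ennreal (\<bar>h (fst p, r (fst (fst p)) (snd p)) - f (fst (fst p), snd p)\<bar>\<^sup>2)"
    have "(\<lambda>p. (fst (fst p), snd p)) \<in> measurable ((P \<Otimes>\<^sub>M Q) \<Otimes>\<^sub>M borel) (P \<Otimes>\<^sub>M borel)"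
      by measurable
    from measurable_compose[OF this r]
    have [measurable]: "(\<lambda>p. r (fst (fst p)) (snd p)) \<in> borel_measurable ((P \<Otimes>\<^sub>M Q) \<Otimes>\<^sub>M borel)"
      by simp
    have "?F \<in> borel_measurable ((P \<Otimes>\<^sub>M Q) \<Otimes>\<^sub>M borel)" by measurable
    from nn_integral_indep_copy_middle[OF \<open>S \<in> measurable M P\<close> V \<open>X \<in> borel_measurable M\<close>
        indep_S_V indep_SV_X this]
    show ?thesis
      by (simp only: mean_square_error_def Tn W_def fst_conv snd_conv)
  qed
  have "mean_square_error M Tn U = (\<integral>\<^sup>+ \<omega>'. mean_square_error M (W \<omega>') U \<partial>M)"
    unfolding U_def using mse_Tn[of "\<lambda>(s, x). rstar x"] by simp
  also have "\<dots> = (\<integral>\<^sup>+ \<omega>'. mean_square_error M (W \<omega>') TX + mean_square_error M TX U \<partial>M)"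
    by (intro nn_integral_cong pythagoras W_G)
  also have "\<dots> = (\<integral>\<^sup>+ \<omega>'. mean_square_error M (W \<omega>') TX \<partial>M) + mean_square_error M TX U"
  proof (subst nn_integral_add)
    show "(\<lambda>\<omega>'. mean_square_error M (W \<omega>') TX) \<in> borel_measurable M"
      unfolding mean_square_error_def W_def TX_def rk_def S_def[symmetric] by measurable
  qed (auto simp: emeasure_space_1)
  also have "(\<integral>\<^sup>+ \<omega>'. mean_square_error M (W \<omega>') TX \<partial>M) = mean_square_error M Tn TX"
    using mse_Tn[of "\<lambda>(s, x). T s (r s x)"] by (simp add: TX_def rk_def S_def)
  finally have risk: "mean_square_error M Tn U = mean_square_error M Tn TX + mean_square_error M TX U" .

  have best: "mean_square_error M TX U \<le> mean_square_error M (\<lambda>\<omega>. f (rk \<omega> (X \<omega>))) U"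
    if [measurable]: "f \<in> borel_measurable borel" for f
  proof -
    have "(\<lambda>\<omega>. f (rk \<omega> (X \<omega>))) \<in> borel_measurable G"
      using measurable_compose[OF SR_G, of "\<lambda>(s, z). f z" borel] by (simp add: rk_def S_def)
    from pythagoras[OF this] show ?thesis by simp
  qed
  have "mean_square_error M Tn U \<le> mean_square_error M Tn TX
      + (INF f \<in> {f \<in> borel_measurable borel. integrable M (\<lambda>\<omega>. \<bar>f (rk \<omega> (X \<omega>))\<bar>\<^sup>2)}.
          mean_square_error M (\<lambda>\<omega>. f (rk \<omega> (X \<omega>))) U)"
    unfolding risk by (intro add_left_mono INF_greatest best) simp
  moreover have "mean_square_error M Tn U
      \<le> (MIN m. mean_square_error M (\<lambda>\<omega>. rk \<omega> (X \<omega>) $ m) U) + mean_square_error M Tn TX"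
    unfolding risk using best[OF borel_measurable_component]
    by (subst add.commute) (auto intro!: add_right_mono Min.boundedI)
  ultimately show ?thesis by (simp add: U_def)
qed

end
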